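(* Let $p$ be a prime and let $R$ be a $p$-ring which is $p$-nil. If $p>2$ then $\Omega_{1}(R^\circ) \leq Z(R^\circ)$, and if $p=2$ then $\Omega_{2}(R^\circ) \leq Z(R^\circ)$; in other words, $R^\circ$ is $p$-central.
   Context: Rings are associative, not necessarily commutative or with identity. A $p$-ring is a ring $R$ whose additive group $R^+$ is a $p$-group. The circle operation on $R$ is $x\circ y=x+y+xy$; $R$ is a monoid under $\circ$ with identity $0$, and the adjoint group $R^\circ$ is the group of invertible elements of this monoid. $R$ is left $p$-nil if, for every $x\in R$, $px=0$ (for $p>2$), respectively $4x=0$ (for $p=2$), implies $xy=0$ for all $y\in R$. $R$ is right $p$-nil if its opposite ring is left $p$-nil, and $p$-nil if it is both left and right $p$-nil. For a group $G$, $\Omega_n(G)$ is the subgroup generated by all $x\in G$ with $x^{p^n}=1$, and $Z(G)$ is the center. A group $G$ is called $p$-central if $\Omega_1(G)\le Z(G)$ when $p>2$, respectively $\Omega_2(G)\le Z(G)$ when $p=2$. *)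

theory Defs
  imports "HOL-Algebra.Ring" "HOL-Algebra.Generated_Groups" "HOL-Computational_Algebra.Primes"
begin

text \<open>
  Rings without identity are represented by the record type of HOL-Algebra rings, whose
  field \<open>one\<close> is left unconstrained and is never referred to.
\<close>

locale nonunital_ring = abelian_group R for R (structure) +
  assumes m_closed: "\<lbrakk>x \<in> carrier R; y \<in> carrier R\<rbrakk> \<Longrightarrow> x \<otimes> y \<in> carrier R"
    and m_assoc: "\<lbrakk>x \<in> carrier R; y \<in> carrier R; z \<in> carrier R\<rbrakk>
      \<Longrightarrow> (x \<otimes> y) \<otimes> z = x \<otimes> (y \<otimes> z)"
    and l_distr: "\<lbrakk>x \<in> carrier R; y \<in> carrier R; z \<in> carrier R\<rbrakk>
      \<Longrightarrow> (x \<oplus> y) \<otimes> z = x \<otimes> z \<oplus> y \<otimes> z"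
    and r_distr: "\<lbrakk>x \<in> carrier R; y \<in> carrier R; z \<in> carrier R\<rbrakk>
      \<Longrightarrow> z \<otimes> (x \<oplus> y) = z \<otimes> x \<oplus> z \<otimes> y"

lemma (in ring) is_nonunital_ring: "nonunital_ring R"
  by unfold_locales (simp_all add: m_assoc l_distr r_distr)

definition opposite_ring :: "('a, 'm) ring_scheme \<Rightarrow> ('a, 'm) ring_scheme" where
  "opposite_ring R = R\<lparr>monoid.mult := \<lambda>x y. y \<otimes>\<^bsub>R\<^esub> x\<rparr>"

text \<open>Groups need not be finite.\<close>

definition p_group :: "nat \<Rightarrow> ('a, 'm) monoid_scheme \<Rightarrow> bool" where
  "p_group p G \<longleftrightarrow> group G \<and> (\<forall>x\<in>carrier G. \<exists>n::nat. x [^]\<^bsub>G\<^esub> (p ^ n) = \<one>\<^bsub>G\<^esub>)"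

definition p_ring :: "nat \<Rightarrow> ('a, 'm) ring_scheme \<Rightarrow> bool" where
  "p_ring p R \<longleftrightarrow> nonunital_ring R \<and> p_group p (add_monoid R)"

definition left_p_nil :: "nat \<Rightarrow> ('a, 'm) ring_scheme \<Rightarrow> bool" where
  "left_p_nil p R \<longleftrightarrow>
    (\<forall>x\<in>carrier R.
      (p > 2 \<and> [p] \<cdot>\<^bsub>R\<^esub> x = \<zero>\<^bsub>R\<^esub> \<or> p = 2 \<and> [(4::nat)] \<cdot>\<^bsub>R\<^esub> x = \<zero>\<^bsub>R\<^esub>)
        \<longrightarrow> (\<forall>y\<in>carrier R. x \<otimes>\<^bsub>R\<^esub> y = \<zero>\<^bsub>R\<^esub>))"

definition right_p_nil :: "nat \<Rightarrow> ('a, 'm) ring_scheme \<Rightarrow> bool" where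
  "right_p_nil p R \<longleftrightarrow> left_p_nil p (opposite_ring R)"

definition p_nil :: "nat \<Rightarrow> ('a, 'm) ring_scheme \<Rightarrow> bool" where
  "p_nil p R \<longleftrightarrow> left_p_nil p R \<and> right_p_nil p R"

definition circle_monoid :: "('a, 'm) ring_scheme \<Rightarrow> 'a monoid" where
  "circle_monoid R =
    \<lparr>carrier = carrier R, monoid.mult = \<lambda>x y. x \<oplus>\<^bsub>R\<^esub> y \<oplus>\<^bsub>R\<^esub> x \<otimes>\<^bsub>R\<^esub> y, one = \<zero>\<^bsub>R\<^esub>\<rparr>"

definition adjoint_group :: "('a, 'm) ring_scheme \<Rightarrow> 'a monoid" where
  "adjoint_group R = units_of (circle_monoid R)"

definition Omega :: "nat \<Rightarrow> nat \<Rightarrow> ('a, 'm) monoid_scheme \<Rightarrow> 'a set" where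
  "Omega p n G = generate G {x \<in> carrier G. x [^]\<^bsub>G\<^esub> (p ^ n) = \<one>\<^bsub>G\<^esub>}"

definition center :: "('a, 'm) monoid_scheme \<Rightarrow> 'a set" where
  "center G = {z \<in> carrier G. \<forall>g\<in>carrier G. z \<otimes>\<^bsub>G\<^esub> g = g \<otimes>\<^bsub>G\<^esub> z}"

definition p_central :: "nat \<Rightarrow> ('a, 'm) monoid_scheme \<Rightarrow> bool" where
  "p_central p G \<longleftrightarrow> group G \<and>
    (p > 2 \<longrightarrow> Omega p 1 G \<subseteq> center G) \<and> (p = 2 \<longrightarrow> Omega p 2 G \<subseteq> center G)"

lemma (in nonunital_ring) opposite_nonunital_ring: "nonunital_ring (opposite_ring R)"
proof -
  have "abelian_group (opposite_ring R)"
    using a_comm_group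
    by (intro abelian_group.intro abelian_monoid.intro abelian_group_axioms.intro)
       (simp_all add: opposite_ring_def comm_group_def)
  then show ?thesis
    by (intro nonunital_ring.intro nonunital_ring_axioms.intro)
       (simp_all add: opposite_ring_def m_closed m_assoc l_distr r_distr)
qed

lemma (in nonunital_ring) zero_mult:
  assumes "x \<in> carrier R"
  shows "\<zero> \<otimes> x = \<zero>" "x \<otimes> \<zero> = \<zero>"
proof -
  have "\<zero> \<otimes> x \<oplus> \<zero> \<otimes> x = \<zero> \<otimes> x"
    using assms l_distr[of \<zero> \<zero> x] by simp
  then show "\<zero> \<otimes> x = \<zero>"
    using assms by (metis add.r_cancel_one m_closed zero_closed)
  have "x \<otimes> \<zero> \<oplus> x \<otimes> \<zero> = x \<otimes> \<zero>"
    using assms r_distr[of \<zero> \<zero> x] by simp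
  then show "x \<otimes> \<zero> = \<zero>"
    using assms by (metis add.r_cancel_one m_closed zero_closed)
qed

lemma (in nonunital_ring) monoid_circle_monoid: "monoid (circle_monoid R)"
  by (intro monoid.intro)
     (simp_all add: circle_monoid_def m_closed m_assoc l_distr r_distr zero_mult a_ac)

lemma (in nonunital_ring) group_adjoint_group: "group (adjoint_group R)"
  unfolding adjoint_group_def by (rule monoid.units_group[OF monoid_circle_monoid])

end

theory Submission
  imports Defs
begin

text \<open>
  Put \<open>q = p\<close> if \<open>p\<close> is odd and \<open>q = 4\<close> if \<open>p = 2\<close>. By hypothesis every \<open>u\<close> with \<open>q u = 0\<close>
  annihilates \<open>R\<close> on both sides, and an annihilating element is central in the adjoint group, because
  \<open>x \<circ> g = x + g = g \<circ> x\<close>. So it is enough to show that \<open>x\<^sup>\<circ>\<^sup>q = 0\<close> implies \<open>q x = 0\<close>, where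
  \<open>x\<^sup>\<circ>\<^sup>q\<close> is the \<open>q\<close>-th power for the circle operation; then the generators of the subgroup in
  question all lie in the center.

  Since \<open>R\<close> is a \<open>p\<close>-ring, \<open>q p\<^sup>j x = 0\<close> for some \<open>j\<close>, and \<open>j\<close> can be lowered to \<open>0\<close> one step at a
  time (lemma \<open>descent_step\<close>). Suppose \<open>q p m x = 0\<close>. Then \<open>p m x\<close> annihilates \<open>R\<close>,
  so \<open>p m x\<^sup>2 = 0\<close>. As \<open>p\<close> divides \<open>q\<close>, also \<open>m x\<^sup>2\<close> annihilates \<open>R\<close>, so \<open>m x\<^sup>3 = 0\<close>.
  Heuristically \<open>x\<^sup>\<circ>\<^sup>q = (1 + x)\<^sup>q - 1\<close>, so that after multiplication by \<open>m\<close> the binomial expansion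
  stops at the quadratic term:
  \<open>0 = m x\<^sup>\<circ>\<^sup>q = m q x + m (q choose 2) x\<^sup>2\<close> (lemma \<open>circle_pow_truncated\<close>).
  The quadratic term vanishes because \<open>p\<close> divides \<open>q choose 2\<close>. This divisibility is the reason
  for taking \<open>q = 4\<close> when \<open>p = 2\<close>. What remains is \<open>q m x = 0\<close>.
\<close>

context nonunital_ring
begin

lemma add_pow_l_mult:
  assumes "x \<in> carrier R" "y \<in> carrier R"
  shows "([(n::nat)] \<cdot> x) \<otimes> y = [n] \<cdot> (x \<otimes> y)"
  using assms by (induction n) (simp_all add: zero_mult l_distr m_closed)

lemma add_pow_dvd_zero:
  assumes "x \<in> carrier R" "[(k::nat)] \<cdot> x = \<zero>" "k dvd n"
  shows "[n] \<cdot> x = \<zero>"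
proof -
  obtain c where "n = k * c" using assms(3) by blast
  then show ?thesis
    using assms(1,2) add.nat_pow_pow[of x c k] by simp
qed

text \<open>
  This is the binomial expansion of \<open>(1 + x)\<^sup>n - 1\<close>, multiplied by \<open>m\<close>; the hypothesis
  \<open>m x\<^sup>3 = 0\<close> removes all terms of degree at least three, so that no powers in a ring without
  identity need to be introduced.
\<close>
lemma circle_pow_truncated:
  assumes x: "x \<in> carrier R"
    and cube: "([(m::nat)] \<cdot> (x \<otimes> x)) \<otimes> x = \<zero>"
  shows "[m] \<cdot> (x [^]\<^bsub>circle_monoid R\<^esub> (n::nat))
    = [(m * n)] \<cdot> x \<oplus> [(m * (n choose 2))] \<cdot> (x \<otimes> x)"
proof (induction n)
  case 0
  then show ?case using x by (simp add: circle_monoid_def m_closed binomial_eq_0)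
next
  case (Suc n)
  interpret C: monoid "circle_monoid R" by (rule monoid_circle_monoid)
  define z where "z = x [^]\<^bsub>circle_monoid R\<^esub> n"
  have z: "z \<in> carrier R"
    using C.nat_pow_closed[of x n] x by (simp add: circle_monoid_def z_def)
  have xx: "x \<otimes> x \<in> carrier R" using x by (simp add: m_closed)
  have quad: "([(m * (n choose 2))] \<cdot> (x \<otimes> x)) \<otimes> x = \<zero>"
    using add_pow_dvd_zero[of "x \<otimes> x \<otimes> x" m "m * (n choose 2)"] cube x xx
    by (simp add: add_pow_l_mult m_closed)
  have "[m] \<cdot> (z \<otimes> x) = ([m] \<cdot> z) \<otimes> x"
    using z x by (simp add: add_pow_l_mult)
  also have "\<dots> = [(m * n)] \<cdot> (x \<otimes> x)"
    using Suc.IH quad x xx by (simp add: z_def[symmetric] l_distr add_pow_l_mult)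
  finally have zx: "[m] \<cdot> (z \<otimes> x) = [(m * n)] \<cdot> (x \<otimes> x)" .
  have "[m] \<cdot> (x [^]\<^bsub>circle_monoid R\<^esub> Suc n) = [m] \<cdot> (z \<oplus> x \<oplus> z \<otimes> x)"
    by (simp add: z_def circle_monoid_def)
  also have "\<dots> = [m] \<cdot> z \<oplus> [m] \<cdot> x \<oplus> [m] \<cdot> (z \<otimes> x)"
    using x z by (simp add: add.nat_pow_distrib m_closed)
  also have "\<dots> = ([(m * n)] \<cdot> x \<oplus> [(m * (n choose 2))] \<cdot> (x \<otimes> x)) \<oplus> [m] \<cdot> x \<oplus> [(m * n)] \<cdot> (x \<otimes> x)"
    using Suc.IH zx by (simp add: z_def)
  also have "\<dots> = ([(m * n)] \<cdot> x \<oplus> [m] \<cdot> x) \<oplus> ([(m * (n choose 2))] \<cdot> (x \<otimes> x) \<oplus> [(m * n)] \<cdot> (x \<otimes> x))"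
    using x xx by (simp add: a_ac)
  also have "\<dots> = [(m * n + m)] \<cdot> x \<oplus> [(m * (n choose 2) + m * n)] \<cdot> (x \<otimes> x)"
    using x xx by (simp add: add.nat_pow_mult)
  also have "m * n + m = m * Suc n" by simp
  also have "m * (n choose 2) + m * n = m * (Suc n choose 2)"
    by (simp add: numeral_2_eq_2 algebra_simps)
  finally show ?case .
qed

text \<open>
  One factor \<open>p\<close> is removed from the additive order of \<open>x\<close>. Two applications of the annihilation
  hypothesis, to \<open>p m x\<close> and to \<open>m x\<^sup>2\<close>, remove everything but the linear term of the expansion.
\<close>
lemma descent_step:
  fixes p q m :: nat
  assumes x: "x \<in> carrier R"
    and ann: "\<And>u y. \<lbrakk>u \<in> carrier R; [q] \<cdot> u = \<zero>; y \<in> carrier R\<rbrakk> \<Longrightarrow> u \<otimes> y = \<zero>"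
    and p_q: "p dvd q" and p_choose: "p dvd q choose 2"
    and pow: "x [^]\<^bsub>circle_monoid R\<^esub> q = \<zero>"
    and ord: "[(q * (p * m))] \<cdot> x = \<zero>"
  shows "[(q * m)] \<cdot> x = \<zero>"
proof -
  have xx: "x \<otimes> x \<in> carrier R" using x by (simp add: m_closed)
  have "[q] \<cdot> ([(p * m)] \<cdot> x) = \<zero>"
    using ord x add.nat_pow_pow[of x q "p * m"] by (simp add: mult.commute)
  then have "([(p * m)] \<cdot> x) \<otimes> x = \<zero>"
    using x by (intro ann) simp_all
  then have sq: "[(p * m)] \<cdot> (x \<otimes> x) = \<zero>"
    by (simp only: add_pow_l_mult[OF x x])
  have "[(m * q)] \<cdot> (x \<otimes> x) = \<zero>"
    by (rule add_pow_dvd_zero[OF xx sq]) (metis p_q dvd_refl mult.commute mult_dvd_mono)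
  then have "[q] \<cdot> ([m] \<cdot> (x \<otimes> x)) = \<zero>"
    using xx add.nat_pow_pow[of "x \<otimes> x" q m] by simp
  then have cube: "([m] \<cdot> (x \<otimes> x)) \<otimes> x = \<zero>"
    using x xx by (intro ann) simp_all
  have quad: "[(m * (q choose 2))] \<cdot> (x \<otimes> x) = \<zero>"
    by (rule add_pow_dvd_zero[OF xx sq]) (metis p_choose dvd_refl mult.commute mult_dvd_mono)
  have "\<zero> = [m] \<cdot> (x [^]\<^bsub>circle_monoid R\<^esub> q)"
    by (simp add: pow)
  also have "\<dots> = [(m * q)] \<cdot> x"
    using circle_pow_truncated[OF x cube, of q] quad x by simp
  finally show ?thesis by (simp add: mult.commute)
qed

lemma circle_torsion_imp_additive_torsion:
  fixes p q :: nat
  assumes x: "x \<in> carrier R"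
    and ann: "\<And>u y. \<lbrakk>u \<in> carrier R; [q] \<cdot> u = \<zero>; y \<in> carrier R\<rbrakk> \<Longrightarrow> u \<otimes> y = \<zero>"
    and p_q: "p dvd q" and p_choose: "p dvd q choose 2"
    and pow: "x [^]\<^bsub>circle_monoid R\<^esub> q = \<zero>"
    and ord: "[(p ^ k)] \<cdot> x = \<zero>"
  shows "[q] \<cdot> x = \<zero>"
proof -
  have "[(q * p ^ k)] \<cdot> x = \<zero>"
    by (rule add_pow_dvd_zero[OF x ord]) simp
  then show ?thesis
  proof (induction k)
    case (Suc k)
    then show ?case
      using descent_step[OF x ann p_q p_choose pow, of "p ^ k"] by simp
  qed simp
qed

lemma annihilator_central:
  assumes x: "x \<in> carrier (adjoint_group R)"
    and ann: "\<And>y. y \<in> carrier R \<Longrightarrow> x \<otimes> y = \<zero>" "\<And>y. y \<in> carrier R \<Longrightarrow> y \<otimes> x = \<zero>"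
  shows "x \<in> center (adjoint_group R)"
  using assms unfolding center_def
  by (auto simp: adjoint_group_def units_of_def Units_def circle_monoid_def a_comm)

end

lemma (in group) subgroup_center: "subgroup (center G) G"
proof (rule subgroupI)
  show "center G \<noteq> {}" by (auto simp: center_def intro!: exI[of _ \<one>])
next
  fix a assume a: "a \<in> center G"
  then have aG: "a \<in> carrier G" by (simp add: center_def)
  show "inv a \<in> center G"
    unfolding center_def
  proof (intro CollectI conjI ballI)
    fix g assume g: "g \<in> carrier G"
    have "a \<otimes> (g \<otimes> inv a) = g \<otimes> a \<otimes> inv a"
      using a aG g by (subst m_assoc[symmetric]) (simp_all add: center_def)
    also have "\<dots> = g" using aG g by (simp add: m_assoc)
    finally show "inv a \<otimes> g = g \<otimes> inv a"
      using aG g by (metis inv_closed inv_solve_left m_closed)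
  qed (simp add: aG)
next
  fix a b assume a: "a \<in> center G" and b: "b \<in> center G"
  have carr: "a \<in> carrier G" "b \<in> carrier G" using a b by (simp_all add: center_def)
  have "a \<otimes> b \<otimes> g = g \<otimes> (a \<otimes> b)" if g: "g \<in> carrier G" for g
  proof -
    have ag: "a \<otimes> g = g \<otimes> a" and bg: "b \<otimes> g = g \<otimes> b"
      using a b g by (simp_all add: center_def)
    have "a \<otimes> b \<otimes> g = a \<otimes> (g \<otimes> b)" using carr g by (simp add: m_assoc bg)
    also have "\<dots> = g \<otimes> a \<otimes> b" using carr g by (simp add: m_assoc[symmetric] ag)
    finally show ?thesis using carr g by (simp add: m_assoc)
  qed
  then show "a \<otimes> b \<in> center G"
    using carr by (simp add: center_def)
qed (auto simp: center_def)

lemma (in nonunital_ring) Omega_subset_center: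
  fixes p e :: nat
  assumes p_grp: "p_group p (add_monoid R)"
    and annl: "\<And>u y. \<lbrakk>u \<in> carrier R; [(p ^ e)] \<cdot> u = \<zero>; y \<in> carrier R\<rbrakk> \<Longrightarrow> u \<otimes> y = \<zero>"
    and annr: "\<And>u y. \<lbrakk>u \<in> carrier R; [(p ^ e)] \<cdot> u = \<zero>; y \<in> carrier R\<rbrakk> \<Longrightarrow> y \<otimes> u = \<zero>"
    and p_q: "p dvd p ^ e" and p_choose: "p dvd (p ^ e choose 2)"
  shows "Omega p e (adjoint_group R) \<subseteq> center (adjoint_group R)"
  unfolding Omega_def
proof (rule group.generate_subgroup_incl[OF group_adjoint_group _
      group.subgroup_center[OF group_adjoint_group]], rule subsetI)
  fix x
  assume "x \<in> {x \<in> carrier (adjoint_group R).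
    x [^]\<^bsub>adjoint_group R\<^esub> (p ^ e) = \<one>\<^bsub>adjoint_group R\<^esub>}"
  then have xG: "x \<in> carrier (adjoint_group R)"
    and pow': "x [^]\<^bsub>adjoint_group R\<^esub> (p ^ e) = \<one>\<^bsub>adjoint_group R\<^esub>" by auto
  have xU: "x \<in> Units (circle_monoid R)"
    using xG by (simp add: adjoint_group_def units_of_def)
  then have x: "x \<in> carrier R"
    by (auto simp: Units_def circle_monoid_def)
  have pow: "x [^]\<^bsub>circle_monoid R\<^esub> (p ^ e) = \<zero>"
    using pow' monoid.units_of_pow[OF monoid_circle_monoid xU, of "p ^ e"]
    by (simp add: adjoint_group_def units_of_one circle_monoid_def)
  obtain k :: nat where "[(p ^ k)] \<cdot> x = \<zero>"
    using p_grp x by (auto simp: p_group_def add_pow_def)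
  then have "[(p ^ e)] \<cdot> x = \<zero>"
    using circle_torsion_imp_additive_torsion[OF x annl p_q p_choose pow] by blast
  then show "x \<in> center (adjoint_group R)"
    using annihilator_central[OF xG] annl annr x by blast
qed

theorem corollaryA:
  fixes R :: "('a, 'm) ring_scheme" and p :: nat
  assumes "prime p"
    and "p_ring p R"
    and "p_nil p R"
  shows "(p > 2 \<longrightarrow> Omega p 1 (adjoint_group R) \<subseteq> center (adjoint_group R))
    \<and> (p = 2 \<longrightarrow> Omega p 2 (adjoint_group R) \<subseteq> center (adjoint_group R))
    \<and> p_central p (adjoint_group R)"
proof -
  interpret nonunital_ring R using assms(2) by (simp add: p_ring_def)
  have p_grp: "p_group p (add_monoid R)" using assms(2) by (simp add: p_ring_def)
  have opp: "carrier (opposite_ring R) = carrier R" "\<zero>\<^bsub>opposite_ring R\<^esub> = \<zero>\<^bsub>R\<^esub>"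
    "\<And>x y. x \<otimes>\<^bsub>opposite_ring R\<^esub> y = y \<otimes>\<^bsub>R\<^esub> x"
    "\<And>(n::nat) x. [n] \<cdot>\<^bsub>opposite_ring R\<^esub> x = [n] \<cdot>\<^bsub>R\<^esub> x"
    by (simp_all add: opposite_ring_def add_pow_def)
  have l: "left_p_nil p R" and r: "left_p_nil p (opposite_ring R)"
    using assms(3) by (simp_all add: p_nil_def right_p_nil_def)
  have odd_case: "Omega p 1 (adjoint_group R) \<subseteq> center (adjoint_group R)" if p: "p > 2"
  proof (rule Omega_subset_center[OF p_grp])
    have "odd p" using assms(1) p by (simp add: prime_odd_nat)
    then obtain c where "p = 2 * c + 1" by (rule oddE)
    then have "p choose 2 = p * c" by (simp add: choose_two)
    then show "p dvd p ^ 1 choose 2" by simp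
  qed (use l r p in \<open>auto simp: left_p_nil_def opp\<close>)
  have even_case: "Omega p 2 (adjoint_group R) \<subseteq> center (adjoint_group R)" if p: "p = 2"
  proof (rule Omega_subset_center[OF p_grp])
    have "(4::nat) choose 2 = 6" by (simp add: choose_two)
    then show "p dvd p ^ 2 choose 2" using p by simp
  qed (use l r p in \<open>auto simp: left_p_nil_def opp\<close>)
  show ?thesis
    using odd_case even_case group_adjoint_group by (simp add: p_central_def)
qed

end
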